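(* Let $\mathfrak{G}=(g_0:\cdots:g_n)$ be a Cremona map of $\mathbb{P}^n$ of degree $d$ with base ideal $I=(g_0,\ldots,g_n)\subset k[\mathbf x]$ and inverse $\mathfrak{G}^{-1}=(g'_0:\cdots:g'_n)$, let $f,g\in k[\mathbf x]$ be relatively prime forms with $\deg(f)\ge1$ and $\deg(g)=d+\deg(f)$, let $\mathfrak{F}=(fg_0:\cdots:fg_n:g):\mathbb{P}^n\dashrightarrow\mathbb{P}^{n+1}$ and $J=(fg_0,\ldots,fg_n,g)\subset k[\mathbf x]$. Let $F\in k[\mathbf y,y_{n+1}]$ be the implicit equation of $\mathfrak F$ and $\delta=\deg(F)$; write $F=F_\delta-y_{n+1}F_{\delta-1}$, where $F_\delta,F_{\delta-1}\in k[\mathbf y]$ are forms of degrees $\delta,\delta-1$, respectively, with $\gcd(F_\delta,F_{\delta-1})=1$. Set $h_\delta:=F_\delta(\mathbf x)$, $h_{\delta-1}:=F_{\delta-1}(\mathbf x)\in k[\mathbf x]$, and consider the monoid parametrization $$\mathfrak{M}:=(h_{\delta-1}x_0:\cdots:h_{\delta-1}x_n:h_\delta):\mathbb{P}^n\dashrightarrow\mathbb{P}^{n+1},$$ with base ideal $K:=(h_{\delta-1}x_0,\ldots,h_{\delta-1}x_n,h_\delta)\subset k[\mathbf x]$. Then: (a) $\mathfrak{F}$ and $\mathfrak{M}$ have the same implicit equation. (b) $\mathfrak{F}=\mathfrak{M}\circ\mathfrak{G}$ as rational maps. (c) Let $\mathcal{R}(J)\simeq k[\mathbf x,\mathbf y,y_{n+1}]/\mathcal{I}_{\mathfrak{F}}$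 and $\mathcal{R}(K)\simeq k[\mathbf x,\mathbf y,y_{n+1}]/\mathcal{I}_{\mathfrak{M}}$ be the presentations of the two Rees algebras based on the given generators. Then $$\mathcal{I}_{\mathfrak{F}}=\mathcal{I}_{\mathfrak{M}}(\mathfrak{G}):C^{\infty}\quad\text{and}\quad\mathcal{I}_{\mathfrak{M}}=\mathcal{I}_{\mathfrak{F}}(\mathfrak{G}^{-1}):D^{\infty},$$ where $\mathcal{I}_{\mathfrak{M}}(\mathfrak{G})$ is the ideal of $k[\mathbf x,\mathbf y,y_{n+1}]$ generated by $\{\mathfrak{h}(g_0,\ldots,g_n;\mathbf y,y_{n+1})\mid\mathfrak{h}(\mathbf x;\mathbf y,y_{n+1})\in\mathcal{I}_{\mathfrak{M}}\}$, $\mathcal{I}_{\mathfrak{F}}(\mathfrak{G}^{-1})$ is the ideal generated by $\{\mathfrak{h}(g'_0(\mathbf x),\ldots,g'_n(\mathbf x);\mathbf y,y_{n+1})\mid\mathfrak{h}(\mathbf x;\mathbf y,y_{n+1})\in\mathcal{I}_{\mathfrak{F}}\}$, and $C=C(\mathbf x)$ and $D=D(\mathbf x)$ are, respectively, the source inversion factor of $\mathfrak{G}$ and the target inversion factor of $\mathfrak{G}$ evaluated at $\mathbf y\mapsto\mathbf x$.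
   Context: $k$ is an infinite field; $\mathbf x=(x_0,\ldots,x_n)$, $\mathbf y=(y_0,\ldots,y_n)$. A Cremona map $\mathfrak G=(g_0:\cdots:g_n)$ of degree $d\ge1$ is a birational map of $\mathbb{P}^n$ onto itself given by forms $g_i\in k[\mathbf x]$ of the same degree $d$ without nonconstant common factor; its inverse is given by forms $g'_i\in k[\mathbf y]$ of the same degree without nonconstant common factor. The target inversion factor is the unique form $D\in k[\mathbf y]$ with $g_i(g'_0,\ldots,g'_n)=y_iD$ for all $i$; the source inversion factor is the unique form $C\in k[\mathbf x]$ with $g'_i(g_0,\ldots,g_n)=x_iC$ for all $i$. The implicit equation of a parametrization $(a_0:\cdots:a_{n+1}):\mathbb{P}^n\dashrightarrow\mathbb{P}^{n+1}$ by forms of the same degree with $\dim k[a_0,\ldots,a_{n+1}]=n+1$ is the irreducible form, unique up to nonzero scalar, generating the kernel of $k[\mathbf y,y_{n+1}]\to k[\mathbf x]$, $y_i\mapsto a_i$. For $\mathfrak F$ as in the claim, the implicit equation has degree $1$ in $y_{n+1}$, so that it can be written as $F_\delta-y_{n+1}F_{\delta-1}$ with $F_\delta,F_{\delta-1}\in k[\mathbf y]$ relatively prime. The presentation ideal of the Rees algebra of $(a_0,\ldots,a_{n+1})\subset k[\mathbf x]$ based on these generators is the kernel of $k[\mathbf x][y_0,\ldots,y_{n+1}]\to k[\mathbf x][t]$, $y_i\mapsto a_it$. For an ideal $\mathfrak a$ and an element $c$, $\mathfrak a:c^\infty=\bigcup_{u\ge0}(\mathfrak a:c^u)$. *)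

theory Defs
  imports
    "HOL-Library.Poly_Mapping"
    "HOL-Library.Cardinality"
    "HOL-Library.Extended_Nat"
    "HOL-Library.Option_ord"
    "HOL-Computational_Algebra.Computational_Algebra"
begin

(* Polynomials over 'k in variables indexed by 'v; the multiplication of the library type
   is convolution along addition of exponent vectors.

   Projective n-space: the coordinates x_0, ..., x_n are indexed by a finite linearly ordered
   type 'n, so CARD('n) = n + 1 (the order makes k[x] an instance of idom). The coordinates y_0, ..., y_(n+1) of (n+1)-space are indexed
   by 'n option: Some i stands for y_i with i <= n, and None for y_(n+1). Then
     k[x], k[y]       is  ('n, 'k) mpoly         (so the renaming p(y) |-> p(x) is the identity),
     k[y, y_(n+1)]    is  ('n option, 'k) mpoly,
     k[x, y, y_(n+1)] is  k[x][y, y_(n+1)], i.e. ('n option, ('n, 'k) mpoly) mpoly. *)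
type_synonym ('v, 'k) mpoly = "('v \<Rightarrow>\<^sub>0 nat) \<Rightarrow>\<^sub>0 'k"

definition mconst :: "'k::zero \<Rightarrow> ('v, 'k) mpoly" where
  "mconst c = Poly_Mapping.single 0 c"

definition mvar :: "'v \<Rightarrow> ('v, 'k::zero_neq_one) mpoly" where
  "mvar i = Poly_Mapping.single (Poly_Mapping.single i 1) 1"

(* For a ring homomorphism \<phi> on the coefficients: the homomorphism that extends \<phi> and
   sends the variable i to v i. *)
definition meval :: "('k::zero \<Rightarrow> 'r::comm_semiring_1) \<Rightarrow> ('v \<Rightarrow> 'r) \<Rightarrow> ('v, 'k) mpoly \<Rightarrow> 'r" where
  "meval \<phi> v p = 
     (\<Sum>m\<in>Poly_Mapping.keys p. \<phi> (Poly_Mapping.lookup p m) *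
        (\<Prod>i\<in>Poly_Mapping.keys m. v i ^ Poly_Mapping.lookup m i))"

(* msubst a p = p(a) *)
definition msubst :: "('v \<Rightarrow> ('w, 'k::comm_semiring_1) mpoly) \<Rightarrow> ('v, 'k) mpoly \<Rightarrow> ('w, 'k) mpoly" where
  "msubst a p = meval mconst a p"


definition exponent_degree :: "('v \<Rightarrow>\<^sub>0 nat) \<Rightarrow> nat" where
  "exponent_degree m = (\<Sum>i\<in>Poly_Mapping.keys m. Poly_Mapping.lookup m i)"

(* The zero polynomial gets degree 0. *)
definition total_degree :: "('v, 'k::zero) mpoly \<Rightarrow> nat" where
  "total_degree p = Max (insert 0 (exponent_degree ` Poly_Mapping.keys p))"

(* The zero polynomial is a form of every degree. *)
definition homogeneous :: "nat \<Rightarrow> ('v, 'k::zero) mpoly \<Rightarrow> bool" where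
  "homogeneous d p \<longleftrightarrow> (\<forall>m\<in>Poly_Mapping.keys p. exponent_degree m = d)"

definition is_form :: "('v, 'k::zero) mpoly \<Rightarrow> bool" where
  "is_form p \<longleftrightarrow> (\<exists>d. homogeneous d p)"

(* The library's coprime lives in algebraic_semidom, which needs a division operation. *)
definition relatively_prime :: "'r::comm_semiring_1 \<Rightarrow> 'r \<Rightarrow> bool" where
  "relatively_prime a b \<longleftrightarrow> (\<forall>c. c dvd a \<longrightarrow> c dvd b \<longrightarrow> c dvd 1)"

definition no_nonconstant_common_factor :: "('i \<Rightarrow> ('v, 'k::comm_semiring_1) mpoly) \<Rightarrow> bool" where
  "no_nonconstant_common_factor a \<longleftrightarrow> (\<forall>c. (\<forall>i. c dvd a i) \<longrightarrow> total_degree c = 0)"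


definition ideal_generated :: "'r::comm_ring_1 set \<Rightarrow> 'r set" where
  "ideal_generated = module.span (*)"

definition ideal_colon :: "'r::comm_ring_1 set \<Rightarrow> 'r \<Rightarrow> 'r set" where
  "ideal_colon A c = {h. h * c \<in> A}"

definition saturation :: "'r::comm_ring_1 set \<Rightarrow> 'r \<Rightarrow> 'r set" where
  "saturation A c = (\<Union>u. ideal_colon A (c ^ u))"

(* P is a prime ideal of the subring A. *)
definition prime_ideal_of :: "'r::comm_ring_1 set \<Rightarrow> 'r set \<Rightarrow> bool" where
  "prime_ideal_of A P \<longleftrightarrow>
     P \<subseteq> A \<and> 0 \<in> P \<and> (\<forall>a\<in>P. \<forall>b\<in>P. a + b \<in> P) \<and> (\<forall>a\<in>A. \<forall>b\<in>P. a * b \<in> P) \<and>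
     1 \<notin> P \<and> (\<forall>a\<in>A. \<forall>b\<in>A. a * b \<in> P \<longrightarrow> a \<in> P \<or> b \<in> P)"

definition krull_dim :: "'r::comm_ring_1 set \<Rightarrow> enat" where
  "krull_dim A =
     Sup {enat m | m. \<exists>P. (\<forall>i\<le>m. prime_ideal_of A (P i)) \<and> (\<forall>i<m. P i \<subset> P (Suc i))}"


(* A tuple a of forms of the same degree, not all zero, represents a rational map from the
   projective space with coordinates 'v to the one with coordinates 'i; two tuples represent
   the same map iff they are proportional over the fraction field. *)
definition rational_map :: "('i \<Rightarrow> ('v, 'k::comm_ring_1) mpoly) \<Rightarrow> bool" where
  "rational_map a \<longleftrightarrow> (\<exists>d. \<forall>i. homogeneous d (a i)) \<and> (\<exists>i. a i \<noteq> 0)"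

definition same_rational_map ::
  "('i \<Rightarrow> ('v, 'k::comm_ring_1) mpoly) \<Rightarrow> ('i \<Rightarrow> ('v, 'k) mpoly) \<Rightarrow> bool" where
  "same_rational_map a b \<longleftrightarrow>
     rational_map a \<and> rational_map b \<and> (\<forall>i j. a i * b j = a j * b i)"

(* Represents b \<circ> a, provided that the resulting tuple is not identically zero. *)
definition rat_comp ::
  "('j \<Rightarrow> ('i, 'k::comm_ring_1) mpoly) \<Rightarrow> ('i \<Rightarrow> ('v, 'k) mpoly) \<Rightarrow> 'j \<Rightarrow> ('v, 'k) mpoly" where
  "rat_comp b a = (\<lambda>j. msubst a (b j))"

definition mutually_inverse ::
  "('n \<Rightarrow> ('n, 'k::comm_ring_1) mpoly) \<Rightarrow> ('n \<Rightarrow> ('n, 'k) mpoly) \<Rightarrow> bool" where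
  "mutually_inverse a b \<longleftrightarrow>
     rational_map a \<and> rational_map b \<and>
     same_rational_map (rat_comp a b) mvar \<and> same_rational_map (rat_comp b a) mvar"

definition birational :: "('n \<Rightarrow> ('n, 'k::comm_ring_1) mpoly) \<Rightarrow> bool" where
  "birational a \<longleftrightarrow> (\<exists>b. mutually_inverse a b)"

definition cremona_map :: "nat \<Rightarrow> ('n \<Rightarrow> ('n, 'k::field) mpoly) \<Rightarrow> bool" where
  "cremona_map d G \<longleftrightarrow>
     d \<ge> 1 \<and> (\<forall>i. homogeneous d (G i)) \<and> no_nonconstant_common_factor G \<and> birational G"

definition cremona_inverse ::
  "('n \<Rightarrow> ('n, 'k::field) mpoly) \<Rightarrow> ('n \<Rightarrow> ('n, 'k) mpoly) \<Rightarrow> bool" where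
  "cremona_inverse G G' \<longleftrightarrow>
     (\<exists>d'. \<forall>i. homogeneous d' (G' i)) \<and> no_nonconstant_common_factor G' \<and> mutually_inverse G G'"

definition target_inversion_factor ::
  "('n \<Rightarrow> ('n, 'k::field) mpoly) \<Rightarrow> ('n \<Rightarrow> ('n, 'k) mpoly) \<Rightarrow> ('n, 'k) mpoly \<Rightarrow> bool" where
  "target_inversion_factor G G' D \<longleftrightarrow> is_form D \<and> (\<forall>i. msubst G' (G i) = mvar i * D)"

definition source_inversion_factor ::
  "('n \<Rightarrow> ('n, 'k::field) mpoly) \<Rightarrow> ('n \<Rightarrow> ('n, 'k) mpoly) \<Rightarrow> ('n, 'k) mpoly \<Rightarrow> bool" where
  "source_inversion_factor G G' C \<longleftrightarrow> is_form C \<and> (\<forall>i. msubst G (G' i) = mvar i * C)"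


(* (a_0 : ... : a_n : b) *)
definition append_coord :: "('n \<Rightarrow> 'r) \<Rightarrow> 'r \<Rightarrow> 'n option \<Rightarrow> 'r" where
  "append_coord a b = case_option b a"

(* k[y] \<subseteq> k[y, y_(n+1)] *)
definition embed_y :: "('n, 'k::comm_semiring_1) mpoly \<Rightarrow> ('n option, 'k) mpoly" where
  "embed_y p = msubst (\<lambda>i. mvar (Some i)) p"

(* The range of (msubst a) is the subalgebra k[a_0, ..., a_(n+1)], and CARD('n) is n + 1. *)
definition implicit_equation ::
  "('n option \<Rightarrow> ('n::finite, 'k::field) mpoly) \<Rightarrow> ('n option, 'k) mpoly \<Rightarrow> bool" where
  "implicit_equation a P \<longleftrightarrow>
     (\<exists>d. \<forall>i. homogeneous d (a i)) \<and>
     krull_dim (range (msubst a)) = enat CARD('n) \<and>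
     is_form P \<and> irreducible P \<and>
     {Q. msubst a Q = 0} = ideal_generated {P}"

(* The kernel of k[x][y_0, ..., y_(n+1)] \<rightarrow> k[x][t], y_i |-> a_i t. *)
definition rees_ideal ::
  "('n option \<Rightarrow> ('n, 'k::field) mpoly) \<Rightarrow> ('n option, ('n, 'k) mpoly) mpoly set" where
  "rees_ideal a = {h. meval (\<lambda>c. [:c:]) (\<lambda>i. Polynomial.monom (a i) 1) h = 0}"

(* h(x; y, y_(n+1)) |-> h(a_0, ..., a_n; y, y_(n+1)) *)
definition subst_x ::
  "('n \<Rightarrow> ('n, 'k::field) mpoly) \<Rightarrow> ('n option, ('n, 'k) mpoly) mpoly
     \<Rightarrow> ('n option, ('n, 'k) mpoly) mpoly" where
  "subst_x a h = meval (\<lambda>c. mconst (msubst a c)) mvar h"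

definition ideal_subst_x ::
  "('n option, ('n, 'k) mpoly) mpoly set \<Rightarrow> ('n \<Rightarrow> ('n, 'k::field) mpoly)
     \<Rightarrow> ('n option, ('n, 'k) mpoly) mpoly set" where
  "ideal_subst_x A a = ideal_generated {subst_x a h | h. h \<in> A}"

end

theory Submission
  imports Defs
begin

text \<open>
  Everything rests on one identity. Substituting the parametrization into its implicit equation
  gives \<open>F\<^sub>\<delta>(f G) = g F\<^sub>\<delta>\<^sub>1(f G)\<close>, and cancelling \<open>f ^ (\<delta> - 1)\<close> by homogeneity leaves
  \<open>f F\<^sub>\<delta>(G) = g F\<^sub>\<delta>\<^sub>1(G)\<close>. This says that the tuple \<open>\<FF>\<close>, multiplied by
  \<open>F\<^sub>\<delta>\<^sub>1(G)\<close>, is \<open>f\<close> times the tuple \<open>\<MM>(G)\<close>; both factors are nonzero. So the two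
  tuples are the same rational map.

  A tuple of forms determines two kernels: that of the substitution into polynomials, whose
  generator is the implicit equation, and that of the map onto the Rees algebra. A homogeneous
  polynomial of degree \<open>j\<close> evaluated at proportional tuples takes values that differ by
  \<open>j\<close>th powers of the nonzero factors, so its vanishing is insensitive to proportionality
  (\<open>proportional_tuples_vanish_iff\<close>). Both kernels are graded, hence both depend only on the
  rational map (\<open>msubst_eq_0_iff_components\<close>, \<open>rees_ideal_proportional\<close>). Moreover the
  substitution \<open>x \<mapsto> G\<close> is injective, because following it by \<open>x \<mapsto> G'\<close> multiplies the
  component of degree \<open>j\<close> by \<open>D ^ j\<close> (\<open>msubst_injective\<close>). Therefore \<open>\<FF>\<close>, \<open>\<MM>(G)\<close>
  and \<open>\<MM>\<close> satisfy the same polynomial relations. The Krull dimension in the definition of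
  implicit equations belongs to a ring isomorphic to the quotient by these relations, so it
  agrees too (\<open>krull_dim_range_cong\<close>).

  For the Rees ideals, substituting \<open>G\<close> for \<open>x\<close> carries the ideal of \<open>\<MM>\<close> into that of
  \<open>\<MM>(G)\<close>, which is the ideal of \<open>\<FF>\<close>; substituting \<open>G'\<close> leads back, as \<open>\<FF>(G')\<close> is
  proportional to \<open>\<MM>\<close>. The round trip multiplies the component of \<open>x\<close>-degree \<open>p\<close> by
  \<open>C ^ p\<close>. Since the Rees ideal of a tuple of forms of equal degree is also graded in \<open>x\<close>, a
  power of \<open>C\<close> moves each of its elements into the ideal generated by the substituted one;
  conversely \<open>C\<close> can be cancelled because the Rees algebra is a domain
  (\<open>rees_ideal_eq_saturation\<close>). The argument is symmetric in the two maps, and the second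
  equality is the same statement with \<open>D\<close> for \<open>C\<close>.
\<close>

section \<open>Ring homomorphisms out of polynomial rings\<close>

locale ring_homomorphism =
  fixes \<phi> :: "'a::comm_semiring_1 \<Rightarrow> 'b::comm_semiring_1"
  assumes zero: "\<phi> 0 = 0" and one: "\<phi> 1 = 1"
    and add: "\<phi> (x + y) = \<phi> x + \<phi> y" and mult: "\<phi> (x * y) = \<phi> x * \<phi> y"
begin

lemma sum: "\<phi> (\<Sum>i\<in>S. u i) = (\<Sum>i\<in>S. \<phi> (u i))"
  by (induction S rule: infinite_finite_induct) (simp_all add: zero add)

lemma prod: "\<phi> (\<Prod>i\<in>S. u i) = (\<Prod>i\<in>S. \<phi> (u i))"
  by (induction S rule: infinite_finite_induct) (simp_all add: one mult)

lemma power: "\<phi> (x ^ n) = \<phi> x ^ n"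
  by (induction n) (simp_all add: one mult)

end

lemma ring_homomorphism_minus:
  fixes \<phi> :: "'a::comm_ring_1 \<Rightarrow> 'b::comm_ring_1"
  assumes "ring_homomorphism \<phi>"
  shows "\<phi> (x - y) = \<phi> x - \<phi> y"
proof -
  interpret ring_homomorphism \<phi> by fact
  show ?thesis using add[of "x - y" y] by simp
qed

lemma ring_homomorphism_id: "ring_homomorphism (\<lambda>c. c)"
  by unfold_locales auto

lemma ring_homomorphism_comp:
  assumes "ring_homomorphism \<phi>" "ring_homomorphism \<psi>"
  shows "ring_homomorphism (\<lambda>x. \<phi> (\<psi> x))"
proof -
  interpret f: ring_homomorphism \<phi> by fact
  interpret g: ring_homomorphism \<psi> by fact
  show ?thesis
    by unfold_locales (simp_all add: f.zero g.zero f.one g.one f.add g.add f.mult g.mult)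
qed

lemma ring_homomorphism_mconst: "ring_homomorphism mconst"
  by unfold_locales (simp_all add: mconst_def single_add mult_single)

lemma ring_homomorphism_const_poly: "ring_homomorphism (\<lambda>c. [:c:])"
  by unfold_locales (simp_all add: one_pCons mult.commute)

lemma ring_homomorphism_map_poly:
  assumes "ring_homomorphism \<phi>"
  shows "ring_homomorphism (map_poly \<phi>)"
proof -
  interpret ring_homomorphism \<phi> by fact
  show ?thesis
    by unfold_locales
      (auto intro!: poly_eqI simp: coeff_map_poly zero one add mult coeff_mult sum one_pCons map_poly_pCons)
qed

definition monomial_value :: "('v \<Rightarrow> 'r::comm_semiring_1) \<Rightarrow> ('v \<Rightarrow>\<^sub>0 nat) \<Rightarrow> 'r" where
  "monomial_value v m = (\<Prod>i\<in>Poly_Mapping.keys m. v i ^ Poly_Mapping.lookup m i)"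

lemma monomial_value_superset:
  assumes "finite S" "Poly_Mapping.keys m \<subseteq> S"
  shows "monomial_value v m = (\<Prod>i\<in>S. v i ^ Poly_Mapping.lookup m i)"
  unfolding monomial_value_def
  by (rule prod.mono_neutral_left) (use assms in \<open>auto simp: in_keys_iff\<close>)

lemma exponent_degree_superset:
  assumes "finite S" "Poly_Mapping.keys m \<subseteq> S"
  shows "exponent_degree m = (\<Sum>i\<in>S. Poly_Mapping.lookup m i)"
  unfolding exponent_degree_def
  by (rule sum.mono_neutral_left) (use assms in \<open>auto simp: in_keys_iff\<close>)

lemma monomial_value_0 [simp]: "monomial_value v 0 = 1"
  by (simp add: monomial_value_def)

lemma exponent_degree_0 [simp]: "exponent_degree 0 = 0"
  by (simp add: exponent_degree_def)

lemma monomial_value_add: "monomial_value v (m + m') = monomial_value v m * monomial_value v m'"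
proof -
  let ?S = "Poly_Mapping.keys m \<union> Poly_Mapping.keys m'"
  have "Poly_Mapping.keys (m + m') \<subseteq> ?S" by (rule keys_add)
  then show ?thesis
    by (simp add: monomial_value_superset[of ?S] lookup_add power_add prod.distrib)
qed

lemma exponent_degree_add: "exponent_degree (m + m') = exponent_degree m + exponent_degree m'"
proof -
  let ?S = "Poly_Mapping.keys m \<union> Poly_Mapping.keys m'"
  have "Poly_Mapping.keys (m + m') \<subseteq> ?S" by (rule keys_add)
  then show ?thesis
    by (simp add: exponent_degree_superset[of ?S] lookup_add sum.distrib)
qed

lemma exponent_degree_single [simp]: "exponent_degree (Poly_Mapping.single i k) = k"
  by (simp add: exponent_degree_def)

lemma monomial_value_single [simp]: "monomial_value v (Poly_Mapping.single i k) = v i ^ k"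
  by (simp add: monomial_value_def)

lemma exponent_degree_eq_0_iff: "exponent_degree m = 0 \<longleftrightarrow> m = 0"
  by (auto simp: exponent_degree_def in_keys_iff intro!: poly_mapping_eqI)

lemma monomial_value_scale:
  "monomial_value (\<lambda>i. c * v i) m = c ^ exponent_degree m * monomial_value v m"
  by (simp add: monomial_value_def exponent_degree_def power_mult_distrib prod.distrib power_sum)

lemma (in ring_homomorphism) monomial_value:
  "\<phi> (monomial_value v m) = monomial_value (\<lambda>i. \<phi> (v i)) m"
  by (simp add: monomial_value_def prod power)

lemma meval_superset:
  assumes "finite S" "Poly_Mapping.keys p \<subseteq> S" "\<phi> 0 = 0"
  shows "meval \<phi> v p = (\<Sum>m\<in>S. \<phi> (Poly_Mapping.lookup p m) * monomial_value v m)"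
  unfolding meval_def monomial_value_def
  by (rule sum.mono_neutral_left) (use assms in \<open>auto simp: in_keys_iff\<close>)

lemma meval_single: "\<phi> 0 = 0 \<Longrightarrow> meval \<phi> v (Poly_Mapping.single m c) = \<phi> c * monomial_value v m"
  by (subst meval_superset[of "{m}"]) auto

lemma mpoly_as_sum:
  fixes p :: "'a \<Rightarrow>\<^sub>0 'b::comm_monoid_add"
  shows "p = (\<Sum>m\<in>Poly_Mapping.keys p. Poly_Mapping.single m (Poly_Mapping.lookup p m))"
  by (rule poly_mapping_eqI)
    (auto simp: lookup_sum lookup_single when_def in_keys_iff sum.delta)

text \<open>Every polynomial is a sum of terms, so properties stable under sums need only be
  checked on terms. Exponent vectors are themselves such finitely supported functions, and the
  rule serves for them too.\<close>

lemma mpoly_induct [case_names zero single add]: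
  fixes p :: "'a \<Rightarrow>\<^sub>0 'b::comm_monoid_add"
  assumes "P 0" "\<And>m c. P (Poly_Mapping.single m c)" "\<And>p q. P p \<Longrightarrow> P q \<Longrightarrow> P (p + q)"
  shows "P p"
proof -
  have "P (\<Sum>m\<in>S. Poly_Mapping.single m (Poly_Mapping.lookup p m))" for S
    by (induction S rule: infinite_finite_induct) (auto intro: assms)
  then show ?thesis by (subst mpoly_as_sum)
qed

lemma meval_add:
  assumes "ring_homomorphism \<phi>"
  shows "meval \<phi> v (p + q) = meval \<phi> v p + meval \<phi> v q"
proof -
  interpret ring_homomorphism \<phi> by fact
  let ?S = "Poly_Mapping.keys p \<union> Poly_Mapping.keys q"
  have "Poly_Mapping.keys (p + q) \<subseteq> ?S" by (rule keys_add)
  then show ?thesis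
    by (simp add: meval_superset[of ?S] zero lookup_add add distrib_right sum.distrib)
qed

lemma ring_homomorphism_meval:
  assumes "ring_homomorphism \<phi>"
  shows "ring_homomorphism (meval \<phi> v)"
proof -
  interpret ring_homomorphism \<phi> by fact
  have single: "meval \<phi> v (Poly_Mapping.single m c * Poly_Mapping.single m' c') =
      meval \<phi> v (Poly_Mapping.single m c) * meval \<phi> v (Poly_Mapping.single m' c')" for m m' c c'
    by (simp add: mult_single meval_single zero mult monomial_value_add ac_simps)
  have zero_value: "meval \<phi> v 0 = 0" by (simp add: meval_def)
  have "meval \<phi> v (Poly_Mapping.single m c * q) =
      meval \<phi> v (Poly_Mapping.single m c) * meval \<phi> v q" for m c q
    by (induction q rule: mpoly_induct)
      (simp_all add: zero_value single meval_add[OF assms] distrib_left)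
  then have "meval \<phi> v (p * q) = meval \<phi> v p * meval \<phi> v q" for p q
    by (induction p rule: mpoly_induct)
      (simp_all add: zero_value meval_add[OF assms] distrib_right)
  moreover have "meval \<phi> v 1 = 1"
    using meval_single[of \<phi> v 0 1] zero by (simp add: one)
  ultimately show ?thesis
    by unfold_locales (simp_all add: zero_value meval_add[OF assms])
qed

lemma meval_mconst [simp]: "\<phi> 0 = 0 \<Longrightarrow> meval \<phi> v (mconst c) = \<phi> c"
  by (simp add: mconst_def meval_single)

lemma meval_mvar [simp]: "\<phi> 0 = 0 \<Longrightarrow> \<phi> 1 = 1 \<Longrightarrow> meval \<phi> v (mvar i) = v i"
  by (simp add: mvar_def meval_single)

lemma mvar_neq_0: "mvar i \<noteq> (0 :: ('v, 'r::zero_neq_one) mpoly)"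
  by (metis mvar_def lookup_single_eq lookup_zero zero_neq_one)

lemma monomial_value_mvar:
  "monomial_value mvar m = (Poly_Mapping.single m 1 :: ('v, 'r::comm_semiring_1) mpoly)"
proof (induction m rule: mpoly_induct)
  case (single i k)
  have "mvar i ^ k = (Poly_Mapping.single (Poly_Mapping.single i k) 1 :: ('v, 'r) mpoly)"
    by (induction k) (simp_all add: mvar_def mult_single single_add[symmetric])
  then show ?case by simp
qed (simp_all add: monomial_value_add mult_single)

lemma single_eq_mconst_times_monomial:
  "Poly_Mapping.single m c = mconst c * monomial_value mvar m"
  by (simp add: monomial_value_mvar mconst_def mult_single)

text \<open>The uniqueness half of the universal property of a polynomial ring; it identifies the
  various composed substitutions below without any computation with coefficients.\<close>

lemma ring_homomorphism_eqI:
  fixes \<phi> \<psi> :: "('v, 'k::comm_semiring_1) mpoly \<Rightarrow> 'r::comm_semiring_1"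
  assumes "ring_homomorphism \<phi>" "ring_homomorphism \<psi>"
    and "\<And>c. \<phi> (mconst c) = \<psi> (mconst c)" and "\<And>i. \<phi> (mvar i) = \<psi> (mvar i)"
  shows "\<phi> p = \<psi> p"
proof -
  interpret f: ring_homomorphism \<phi> by fact
  interpret g: ring_homomorphism \<psi> by fact
  show ?thesis
    by (induction p rule: mpoly_induct)
      (simp_all add: f.zero g.zero f.add g.add single_eq_mconst_times_monomial f.mult g.mult
        f.monomial_value g.monomial_value assms(3,4))
qed

lemma ring_homomorphism_msubst: "ring_homomorphism (msubst a)"
  unfolding msubst_def by (intro ring_homomorphism_meval ring_homomorphism_mconst)

lemma msubst_mconst [simp]: "msubst a (mconst c) = mconst c"
  by (simp add: msubst_def mconst_def[of 0])

lemma msubst_mvar [simp]: "msubst a (mvar i) = a i"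
  by (simp add: msubst_def mconst_def)

lemma msubst_msubst: "msubst b (msubst a p) = msubst (\<lambda>i. msubst b (a i)) p"
  by (rule ring_homomorphism_eqI[where \<phi> = "\<lambda>p. msubst b (msubst a p)"])
    (simp_all add: ring_homomorphism_comp ring_homomorphism_msubst)

lemma msubst_mvar_id [simp]: "msubst mvar p = p"
  by (rule ring_homomorphism_eqI[where \<psi> = "\<lambda>p. p"])
    (simp_all add: ring_homomorphism_msubst ring_homomorphism_id)

lemma ring_homomorphism_subst_x: "ring_homomorphism (subst_x a)"
  unfolding subst_x_def
  by (intro ring_homomorphism_meval ring_homomorphism_comp[OF ring_homomorphism_mconst]
      ring_homomorphism_msubst)

section \<open>Homogeneous components\<close>

definition hom_component :: "nat \<Rightarrow> ('v, 'k::zero) mpoly \<Rightarrow> ('v, 'k) mpoly" where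
  "hom_component e p = 
    Poly_Mapping.mapp (\<lambda>m c. if exponent_degree m = e then c else 0) p"

lemma lookup_hom_component:
  "Poly_Mapping.lookup (hom_component e p) m =
    (if exponent_degree m = e then Poly_Mapping.lookup p m else 0)"
  by (auto simp: hom_component_def lookup_mapp when_def in_keys_iff)

lemma keys_hom_component: "Poly_Mapping.keys (hom_component e p) \<subseteq> Poly_Mapping.keys p"
  by (auto simp: in_keys_iff lookup_hom_component split: if_splits)

lemma hom_component_0 [simp]: "hom_component e 0 = 0"
  by (rule poly_mapping_eqI) (simp add: lookup_hom_component)

lemma hom_component_sum: "hom_component e (\<Sum>i\<in>S. p i) = (\<Sum>i\<in>S. hom_component e (p i))"
  by (rule poly_mapping_eqI) (simp add: lookup_hom_component lookup_sum)

lemma homogeneous_hom_component [simp]: "homogeneous e (hom_component e p)"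
  by (auto simp: homogeneous_def in_keys_iff lookup_hom_component split: if_splits)

lemma hom_component_of_homogeneous:
  "homogeneous d p \<Longrightarrow> hom_component e p = (if e = d then p else 0)"
  by (rule poly_mapping_eqI) (auto simp: lookup_hom_component homogeneous_def in_keys_iff)

lemma sum_hom_components:
  "(\<Sum>e\<in>exponent_degree ` Poly_Mapping.keys p. hom_component e p) = p"
  by (rule poly_mapping_eqI) (auto simp: lookup_sum lookup_hom_component in_keys_iff sum.delta)

lemma homogeneous_mconst [simp]: "homogeneous 0 (mconst c)"
  by (simp add: homogeneous_def mconst_def)

lemma homogeneous_1 [simp]: "homogeneous 0 1"
  by (simp add: homogeneous_def)

lemma homogeneous_mvar [simp]: "homogeneous 1 (mvar i)"
  by (simp add: homogeneous_def mvar_def)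

lemma homogeneous_mult:
  assumes "homogeneous d p" "homogeneous e q"
  shows "homogeneous (d + e) (p * q)"
  using keys_mult[of p q] assms by (fastforce simp: homogeneous_def exponent_degree_add)

lemma homogeneous_sum:
  assumes "\<And>i. i \<in> S \<Longrightarrow> homogeneous d (p i)"
  shows "homogeneous d (\<Sum>i\<in>S. p i)"
  using assms keys_sum[of p S] unfolding homogeneous_def by blast

lemma homogeneous_power: "homogeneous e p \<Longrightarrow> homogeneous (k * e) (p ^ k)"
  by (induction k) (simp_all add: homogeneous_mult)

lemma homogeneous_monomial_value:
  fixes a :: "'v \<Rightarrow> ('w, 'k::comm_semiring_1) mpoly"
  assumes "\<And>i. homogeneous e (a i)"
  shows "homogeneous (exponent_degree m * e) (monomial_value a m)"
  by (induction m rule: mpoly_induct)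
    (simp_all add: monomial_value_add exponent_degree_add distrib_right homogeneous_mult
      homogeneous_power assms)

lemma homogeneous_total_degree:
  assumes "is_form p" "p \<noteq> 0"
  shows "homogeneous (total_degree p) p"
proof -
  obtain d where d: "homogeneous d p" using assms(1) by (auto simp: is_form_def)
  have "Poly_Mapping.keys p \<noteq> {}"
  proof
    assume "Poly_Mapping.keys p = {}"
    then have "p = 0" by (intro poly_mapping_eqI) (auto simp: in_keys_iff)
    then show False using assms by simp
  qed
  then have "exponent_degree ` Poly_Mapping.keys p = {d}" using d by (force simp: homogeneous_def image_constant_conv)
  then have "total_degree p = d" by (simp add: total_degree_def)
  then show ?thesis using d by simp
qed

lemma total_degree_eq_0D:
  assumes "total_degree p = 0"
  shows "p = mconst (Poly_Mapping.lookup p 0)"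
proof -
  have "exponent_degree m = 0" if "m \<in> Poly_Mapping.keys p" for m
  proof -
    have "exponent_degree m \<le> total_degree p"
      unfolding total_degree_def using that by (intro Max_ge) auto
    then show ?thesis using assms by simp
  qed
  then have "Poly_Mapping.keys p \<subseteq> {0}" by (auto simp: exponent_degree_eq_0_iff)
  then show ?thesis
    by (intro poly_mapping_eqI) (auto simp: mconst_def lookup_single when_def in_keys_iff)
qed

lemma hom_component_mult_homogeneous:
  fixes q r :: "('v, 'k::comm_ring_1) mpoly"
  assumes "homogeneous e r"
  shows "hom_component (k + e) (q * r) = hom_component k q * r"
proof -
  let ?D = "exponent_degree ` Poly_Mapping.keys q"
  have zero: "hom_component k q = 0" if "k \<notin> ?D"
    by (rule poly_mapping_eqI) (use that in \<open>auto simp: lookup_hom_component in_keys_iff\<close>)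
  have "hom_component (k + e) (q * r) = (\<Sum>j\<in>?D. hom_component (k + e) (hom_component j q * r))"
    by (subst sum_hom_components[of q, symmetric]) (simp add: hom_component_sum sum_distrib_right)
  also have "\<dots> = (\<Sum>j\<in>?D. if j = k then hom_component k q * r else 0)"
    by (intro sum.cong refl)
      (simp add: hom_component_of_homogeneous[OF homogeneous_mult[OF homogeneous_hom_component assms]])
  also have "\<dots> = hom_component k q * r" using zero by (auto simp: sum.delta)
  finally show ?thesis .
qed

lemma meval_hom_component:
  assumes "\<phi> 0 = 0"
  shows "meval \<phi> v (hom_component j p) =
    (\<Sum>m\<in>Poly_Mapping.keys p. if exponent_degree m = j then
      \<phi> (Poly_Mapping.lookup p m) * monomial_value v m else 0)"
  by (subst meval_superset[of "Poly_Mapping.keys p" "hom_component j p" \<phi> v])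
    (auto intro!: sum.cong simp: lookup_hom_component assms keys_hom_component)

lemma meval_scale_homogeneous:
  assumes "homogeneous j p"
  shows "meval \<phi> (\<lambda>i. c * v i) p = c ^ j * meval \<phi> v p"
  using assms
  by (auto simp: meval_def monomial_value_def[symmetric] monomial_value_scale sum_distrib_left
      homogeneous_def ac_simps intro!: sum.cong)

text \<open>This is the round trip through a Cremona map and its inverse, with the inversion factor
  as \<open>c\<close>: on forms it is multiplication by a power of that factor.\<close>

lemma msubst_multiple_of_variables:
  assumes "homogeneous j p"
  shows "msubst (\<lambda>i. mvar i * c) p = c ^ j * p"
proof -
  have "msubst (\<lambda>i. mvar i * c) p = meval mconst (\<lambda>i. c * mvar i) p"
    by (simp only: msubst_def mult.commute)
  also have "\<dots> = c ^ j * msubst mvar p"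
    by (simp only: meval_scale_homogeneous[OF assms] msubst_def)
  finally show ?thesis by simp
qed

lemma homogeneous_msubst:
  assumes "\<And>i. homogeneous e (a i)" "homogeneous j p"
  shows "homogeneous (j * e) (msubst a p)"
  unfolding msubst_def meval_def monomial_value_def[symmetric]
proof (rule homogeneous_sum)
  fix m assume "m \<in> Poly_Mapping.keys p"
  then have "exponent_degree m = j" using assms(2) by (auto simp: homogeneous_def)
  then show "homogeneous (j * e) (mconst (Poly_Mapping.lookup p m) * monomial_value a m)"
    using homogeneous_mult[OF homogeneous_mconst homogeneous_monomial_value[of e a m, OF assms(1)]]
    by simp
qed

text \<open>Substituting forms of degree \<open>e\<close> turns degree \<open>j\<close> into degree \<open>j * e\<close>. For positive
  \<open>e\<close> these are distinct for distinct \<open>j\<close>, so the images of the components cannot cancel; for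
  \<open>e = 0\<close> they could.\<close>

lemma msubst_eq_0_iff_components:
  assumes "\<And>i. homogeneous e (a i)" "e \<ge> 1"
  shows "msubst a p = 0 \<longleftrightarrow> (\<forall>j. msubst a (hom_component j p) = 0)"
proof
  interpret ring_homomorphism "msubst a" by (rule ring_homomorphism_msubst)
  {
    assume *: "\<forall>j. msubst a (hom_component j p) = 0"
    show "msubst a p = 0"
      by (subst sum_hom_components[symmetric]) (simp add: sum *)
  }
  assume *: "msubst a p = 0"
  show "\<forall>j. msubst a (hom_component j p) = 0"
  proof
    fix j
    let ?D = "exponent_degree ` Poly_Mapping.keys p"
    have "0 = hom_component (j * e) (msubst a p)" by (simp add: *)
    also have "\<dots> = (\<Sum>i\<in>?D. hom_component (j * e) (msubst a (hom_component i p)))"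
      by (subst sum_hom_components[of p, symmetric]) (simp only: sum hom_component_sum)
    also have "\<dots> = (\<Sum>i\<in>?D. if i = j then msubst a (hom_component j p) else 0)"
      by (intro sum.cong refl) (use assms(2) in
        \<open>simp add: hom_component_of_homogeneous[OF homogeneous_msubst[OF assms(1) homogeneous_hom_component]]\<close>)
    also have "\<dots> = (if j \<in> ?D then msubst a (hom_component j p) else 0)"
      by (simp add: sum.delta)
    finally have "j \<in> ?D \<Longrightarrow> msubst a (hom_component j p) = 0" by simp
    moreover have "hom_component j p = 0" if "j \<notin> ?D"
      by (rule poly_mapping_eqI) (use that in \<open>auto simp: lookup_hom_component in_keys_iff\<close>)
    ultimately show "msubst a (hom_component j p) = 0" by (cases "j \<in> ?D") (auto simp: zero)
  qed
qed

lemma proportional_tuples_vanish_iff: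
  fixes a b :: "'v \<Rightarrow> 'r::idom"
  assumes "homogeneous j p" "c \<noteq> 0" "c' \<noteq> 0" "\<And>i. c * a i = c' * b i"
  shows "meval \<phi> a p = 0 \<longleftrightarrow> meval \<phi> b p = 0"
proof -
  have "c ^ j * meval \<phi> a p = c' ^ j * meval \<phi> b p"
    using meval_scale_homogeneous[OF assms(1), of \<phi> c a]
      meval_scale_homogeneous[OF assms(1), of \<phi> c' b] assms(4) by simp
  then show ?thesis using assms(2,3)
    by (metis mult_eq_0_iff power_not_zero)
qed

text \<open>The substitution has a left inverse up to the factors \<open>C ^ j\<close> in degree \<open>j\<close>; these lie in
  a domain and can be cancelled degree by degree. The degree \<open>1 + deg C\<close> of \<open>mvar i * C\<close> is
  positive even when \<open>C\<close> is a constant.\<close>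

lemma msubst_injective:
  fixes a :: "'v::linorder \<Rightarrow> ('w, 'k::idom) mpoly" and C :: "('v, 'k) mpoly"
  assumes "\<And>i. msubst b (a i) = mvar i * C" "is_form C" "C \<noteq> 0" "msubst a p = 0"
  shows "p = 0"
proof (rule poly_mapping_eqI)
  fix m :: "'v \<Rightarrow>\<^sub>0 nat"
  obtain c where c: "homogeneous c C" using assms(2) by (auto simp: is_form_def)
  interpret ring_homomorphism "msubst b" by (rule ring_homomorphism_msubst)
  let ?j = "exponent_degree m"
  have "msubst (\<lambda>i. mvar i * C) p = msubst b (msubst a p)"
    by (simp only: msubst_msubst assms(1))
  also have "\<dots> = 0" by (simp add: assms(4) zero)
  finally have "msubst (\<lambda>i. mvar i * C) (hom_component ?j p) = 0"
    using msubst_eq_0_iff_components[of "1 + c" "\<lambda>i. mvar i * C" p] homogeneous_mult[OF homogeneous_mvar c]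
    by auto
  then have "C ^ ?j * hom_component ?j p = 0"
    by (simp only: msubst_multiple_of_variables[OF homogeneous_hom_component])
  then have "hom_component ?j p = 0" using assms(3) by auto
  then have "Poly_Mapping.lookup (hom_component ?j p) m = 0" by simp
  then show "Poly_Mapping.lookup p m = Poly_Mapping.lookup 0 m" by (simp add: lookup_hom_component)
qed

section \<open>Krull dimension of the image of a homomorphism\<close>

text \<open>Two homomorphisms with the same fibres have isomorphic images. The isomorphism is not
  constructed: ideals are moved by pulling them back to the common source and pushing them
  forward again.\<close>

lemma prime_ideal_of_transport:
  assumes "ring_homomorphism \<phi>" "ring_homomorphism \<psi>"
    and ker: "\<And>x y. \<phi> x = \<phi> y \<longleftrightarrow> \<psi> x = \<psi> y"
    and P: "prime_ideal_of (range \<phi>) P"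
  shows "prime_ideal_of (range \<psi>) (\<psi> ` (\<phi> -` P))"
proof -
  interpret f: ring_homomorphism \<phi> by fact
  interpret g: ring_homomorphism \<psi> by fact
  have mem: "\<psi> x \<in> \<psi> ` (\<phi> -` P) \<longleftrightarrow> \<phi> x \<in> P" for x
    by (metis (no_types, lifting) image_iff vimage_eq ker)
  have P0: "\<phi> 0 \<in> P" and P1: "\<phi> 1 \<notin> P"
    and Padd: "\<And>x y. \<phi> x \<in> P \<Longrightarrow> \<phi> y \<in> P \<Longrightarrow> \<phi> (x + y) \<in> P"
    and Pmult: "\<And>x y. \<phi> y \<in> P \<Longrightarrow> \<phi> (x * y) \<in> P"
    and Pprime: "\<And>x y. \<phi> (x * y) \<in> P \<Longrightarrow> \<phi> x \<in> P \<or> \<phi> y \<in> P"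
    using P by (auto simp: prime_ideal_of_def f.zero f.one f.add f.mult)
  show ?thesis
    unfolding prime_ideal_of_def
  proof (intro conjI ballI impI)
    show "0 \<in> \<psi> ` (\<phi> -` P)" using mem[of 0] P0 by (simp add: g.zero)
    show "1 \<notin> \<psi> ` (\<phi> -` P)" using mem[of 1] P1 by (simp add: g.one)
  next
    fix u w assume "u \<in> \<psi> ` (\<phi> -` P)" "w \<in> \<psi> ` (\<phi> -` P)"
    then show "u + w \<in> \<psi> ` (\<phi> -` P)"
      using Padd mem by (auto simp: g.add[symmetric])
  next
    fix u w assume "u \<in> range \<psi>" "w \<in> \<psi> ` (\<phi> -` P)"
    then show "u * w \<in> \<psi> ` (\<phi> -` P)"
      using Pmult mem by (auto simp: g.mult[symmetric])
  next
    fix u w assume "u \<in> range \<psi>" "w \<in> range \<psi>" "u * w \<in> \<psi> ` (\<phi> -` P)"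
    then obtain x y where "u = \<psi> x" "w = \<psi> y" "\<psi> (x * y) \<in> \<psi> ` (\<phi> -` P)"
      by (auto simp: g.mult)
    then show "u \<in> \<psi> ` (\<phi> -` P) \<or> w \<in> \<psi> ` (\<phi> -` P)"
      using Pprime mem by auto
  qed auto
qed

lemma krull_dim_range_le:
  assumes "ring_homomorphism \<phi>" "ring_homomorphism \<psi>"
    and ker: "\<And>x y. \<phi> x = \<phi> y \<longleftrightarrow> \<psi> x = \<psi> y"
  shows "krull_dim (range \<phi>) \<le> krull_dim (range \<psi>)"
  unfolding krull_dim_def
proof (rule Sup_subset_mono, clarify)
  fix m P
  assume P: "\<forall>i\<le>m. prime_ideal_of (range \<phi>) (P i)" "\<forall>i<m. P i \<subset> P (Suc i)"
  have mem: "\<psi> x \<in> \<psi> ` (\<phi> -` Q) \<longleftrightarrow> \<phi> x \<in> Q" for x Q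
    by (metis (no_types, lifting) image_iff vimage_eq ker)
  let ?Q = "\<lambda>i. \<psi> ` (\<phi> -` P i)"
  have "\<forall>i\<le>m. prime_ideal_of (range \<psi>) (?Q i)"
    using P(1) prime_ideal_of_transport[OF assms] by blast
  moreover have "?Q i \<subset> ?Q (Suc i)" if i: "i < m" for i
  proof -
    have "P (Suc i) \<subseteq> range \<phi>" using P(1) that by (auto simp: prime_ideal_of_def)
    then obtain x where "\<phi> x \<in> P (Suc i)" "\<phi> x \<notin> P i"
      using P(2)[rule_format, OF i] by blast
    then have "\<psi> x \<in> ?Q (Suc i)" "\<psi> x \<notin> ?Q i" by (simp_all only: mem not_False_eq_True)
    moreover have "?Q i \<subseteq> ?Q (Suc i)" using P(2) that by blast
    ultimately show ?thesis by blast
  qed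
  ultimately show "\<exists>m'. enat m = enat m' \<and> (\<exists>P. (\<forall>i\<le>m'. prime_ideal_of (range \<psi>) (P i)) \<and> (\<forall>i<m'. P i \<subset> P (Suc i)))"
    by (intro exI[of _ m] exI[of _ ?Q] conjI refl allI impI) simp_all
qed

lemma krull_dim_range_cong:
  fixes \<phi> :: "'a::comm_ring_1 \<Rightarrow> 'b::comm_ring_1" and \<psi> :: "'a \<Rightarrow> 'c::comm_ring_1"
  assumes "ring_homomorphism \<phi>" "ring_homomorphism \<psi>"
    and "\<And>x. \<phi> x = 0 \<longleftrightarrow> \<psi> x = 0"
  shows "krull_dim (range \<phi>) = krull_dim (range \<psi>)"
proof -
  have ker: "\<phi> x = \<phi> y \<longleftrightarrow> \<psi> x = \<psi> y" for x y
    using assms(3)[of "x - y"] by (simp add: ring_homomorphism_minus[OF assms(1)]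
        ring_homomorphism_minus[OF assms(2)])
  show ?thesis
    by (intro antisym krull_dim_range_le assms(1,2)) (simp_all only: ker)
qed

section \<open>Rees ideals\<close>

text \<open>The power of \<open>t\<close> records the degree in \<open>y\<close>, so vanishing in \<open>k[x][t]\<close> is vanishing
  of each \<open>y\<close>-component at the tuple itself.\<close>

lemma rees_ideal_components:
  "h \<in> rees_ideal a \<longleftrightarrow> (\<forall>j. meval (\<lambda>c. c) a (hom_component j h) = 0)"
proof -
  have monomials: "monomial_value (\<lambda>i. Polynomial.monom (a i) 1) m =
      Polynomial.monom (monomial_value a m) (exponent_degree m)" for m
  proof -
    have "(\<lambda>i. Polynomial.monom (a i) 1) = (\<lambda>i. Polynomial.monom 1 1 * [:a i:])"
      by (simp add: monom_altdef fun_eq_iff)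
    then have "monomial_value (\<lambda>i. Polynomial.monom (a i) 1) m =
        Polynomial.monom 1 1 ^ exponent_degree m * [:monomial_value a m:]"
      using ring_homomorphism.monomial_value[OF ring_homomorphism_const_poly, of a m]
      by (simp only: monomial_value_scale)
    then show ?thesis by (simp add: monom_altdef)
  qed
  have "coeff (meval (\<lambda>c. [:c:]) (\<lambda>i. Polynomial.monom (a i) 1) h) j =
      meval (\<lambda>c. c) a (hom_component j h)" for j
    unfolding meval_def[where \<phi> = "\<lambda>c. [:c:]"] monomial_value_def[symmetric] monomials coeff_sum
    by (auto simp: meval_hom_component intro!: sum.cong)
  then show ?thesis by (auto simp: rees_ideal_def poly_eq_iff)
qed

lemma rees_ideal_proportional:
  assumes "c \<noteq> 0" "c' \<noteq> 0" "\<And>i. c * a i = c' * b i"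
  shows "rees_ideal a = rees_ideal (b :: 'n::linorder option \<Rightarrow> ('n, 'k::field) mpoly)"
  using proportional_tuples_vanish_iff[where a = a and b = b and \<phi> = "\<lambda>c. c", OF homogeneous_hom_component assms]
  by (simp add: rees_ideal_components set_eq_iff)

lemma rees_ideal_kernel:
  obtains \<Phi> :: "('n option, ('n, 'k::field) mpoly) mpoly \<Rightarrow> ('n, 'k) mpoly poly"
  where "ring_homomorphism \<Phi>" "\<And>h. h \<in> rees_ideal a \<longleftrightarrow> \<Phi> h = 0" "\<And>c. \<Phi> (mconst c) = [:c:]"
  by (rule that[of "meval (\<lambda>c. [:c:]) (\<lambda>i. Polynomial.monom (a i) 1)"])
    (simp_all add: ring_homomorphism_meval ring_homomorphism_const_poly rees_ideal_def)

text \<open>Applying the substitution to the coefficients of \<open>k[x][t]\<close> carries the Rees map of \<open>a\<close> to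
  that of the substituted tuple; by uniqueness this needs checking on constants and variables
  only.\<close>

lemma subst_x_in_rees_ideal:
  assumes "h \<in> rees_ideal a"
  shows "subst_x b h \<in> rees_ideal (\<lambda>i. msubst b (a i))"
proof -
  interpret s: ring_homomorphism "msubst b" by (rule ring_homomorphism_msubst)
  interpret c: ring_homomorphism mconst by (rule ring_homomorphism_mconst)
  let ?E = "\<lambda>a. meval (\<lambda>c. [:c:]) (\<lambda>i. Polynomial.monom (a i) 1)"
  have "?E (\<lambda>i. msubst b (a i)) (subst_x b h) = map_poly (msubst b) (?E a h)"
  proof (rule ring_homomorphism_eqI[where p = h])
    show "ring_homomorphism (\<lambda>h. ?E (\<lambda>i. msubst b (a i)) (subst_x b h))"
      by (rule ring_homomorphism_comp[OF ring_homomorphism_meval[OF ring_homomorphism_const_poly]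
            ring_homomorphism_subst_x])
    show "ring_homomorphism (\<lambda>h. map_poly (msubst b) (?E a h))"
      by (rule ring_homomorphism_comp[OF ring_homomorphism_map_poly[OF ring_homomorphism_msubst]
            ring_homomorphism_meval[OF ring_homomorphism_const_poly]])
  qed (simp_all add: subst_x_def s.zero s.one map_poly_pCons map_poly_monom one_pCons c.zero c.one)
  then show ?thesis using assms by (simp add: rees_ideal_def)
qed

definition x_component ::
  "nat \<Rightarrow> ('w, ('v, 'k::zero) mpoly) mpoly \<Rightarrow> ('w, ('v, 'k) mpoly) mpoly" where
  "x_component p h = Poly_Mapping.map (hom_component p) h"

lemma lookup_x_component:
  "Poly_Mapping.lookup (x_component p h) m = hom_component p (Poly_Mapping.lookup h m)"
  by (simp add: x_component_def map.rep_eq when_def)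

text \<open>At a tuple of forms of degree \<open>e\<close>, the part of bidegree \<open>(p, j)\<close> in \<open>(x, y)\<close> takes a
  value of degree \<open>p + j * e\<close>. For fixed \<open>j\<close> these degrees separate the \<open>x\<close>-components.\<close>

lemma x_component_in_rees_ideal:
  fixes a :: "'n option \<Rightarrow> ('n, 'k::field) mpoly"
  assumes "\<And>i. homogeneous e (a i)" "h \<in> rees_ideal a"
  shows "x_component p h \<in> rees_ideal a"
  unfolding rees_ideal_components
proof
  fix j
  have keys: "Poly_Mapping.keys (hom_component j (x_component p h)) \<subseteq> Poly_Mapping.keys h"
    by (auto simp: in_keys_iff lookup_hom_component lookup_x_component split: if_splits)
  have "meval (\<lambda>c. c) a (hom_component j (x_component p h)) =
      (\<Sum>m\<in>Poly_Mapping.keys h.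
        Poly_Mapping.lookup (hom_component j (x_component p h)) m * monomial_value a m)"
    by (rule meval_superset[where \<phi> = "\<lambda>c. c", OF finite_keys keys refl])
  also have "\<dots> = (\<Sum>m\<in>Poly_Mapping.keys h. hom_component (p + j * e)
      (if exponent_degree m = j then Poly_Mapping.lookup h m * monomial_value a m else 0))"
  proof (rule sum.cong[OF refl])
    fix m
    have "hom_component (p + exponent_degree m * e) (Poly_Mapping.lookup h m * monomial_value a m) =
        hom_component p (Poly_Mapping.lookup h m) * monomial_value a m"
      by (intro hom_component_mult_homogeneous homogeneous_monomial_value assms(1))
    then show "Poly_Mapping.lookup (hom_component j (x_component p h)) m * monomial_value a m =
        hom_component (p + j * e)
          (if exponent_degree m = j then Poly_Mapping.lookup h m * monomial_value a m else 0)"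
      by (auto simp: lookup_hom_component lookup_x_component)
  qed
  also have "\<dots> = hom_component (p + j * e) (meval (\<lambda>c. c) a (hom_component j h))"
    by (simp add: meval_hom_component hom_component_sum)
  also have "\<dots> = 0" using assms(2) by (simp add: rees_ideal_components)
  finally show "meval (\<lambda>c. c) a (hom_component j (x_component p h)) = 0" .
qed

lemma sum_x_components:
  obtains S where "finite S" "h = (\<Sum>p\<in>S. x_component p h)"
proof
  let ?S = "\<Union>m\<in>Poly_Mapping.keys h. exponent_degree ` Poly_Mapping.keys (Poly_Mapping.lookup h m)"
  show "finite ?S" by simp
  show "h = (\<Sum>p\<in>?S. x_component p h)"
  proof (intro poly_mapping_eqI)
    fix m n
    have "exponent_degree n \<in> ?S" if "Poly_Mapping.lookup (Poly_Mapping.lookup h m) n \<noteq> 0"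
      using that by (force simp: in_keys_iff)
    then show "Poly_Mapping.lookup (Poly_Mapping.lookup h m) n =
        Poly_Mapping.lookup (Poly_Mapping.lookup (\<Sum>p\<in>?S. x_component p h) m) n"
      using \<open>finite ?S\<close>
      by (simp add: lookup_sum lookup_x_component lookup_hom_component sum.delta del: UN_iff finite_UN) blast
  qed
qed

lemma subst_x_roundtrip:
  assumes "\<And>i. msubst G (G' i) = mvar i * C"
  shows "subst_x G (subst_x G' (x_component p h)) = mconst C ^ p * x_component p h"
proof -
  interpret s: ring_homomorphism "msubst G" by (rule ring_homomorphism_msubst)
  interpret s': ring_homomorphism "msubst G'" by (rule ring_homomorphism_msubst)
  interpret c: ring_homomorphism mconst by (rule ring_homomorphism_mconst)
  have round: "msubst G (msubst G' q) = C ^ p * q" if "homogeneous p q" for q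
    by (simp only: msubst_msubst assms msubst_multiple_of_variables[OF that])
  have "subst_x G (subst_x G' (x_component p h)) =
      meval (\<lambda>c. mconst (msubst G (msubst G' c))) mvar (x_component p h)"
  proof (rule ring_homomorphism_eqI[where p = "x_component p h"])
    show "ring_homomorphism (\<lambda>h. subst_x G (subst_x G' h))"
      by (rule ring_homomorphism_comp[OF ring_homomorphism_subst_x ring_homomorphism_subst_x])
    show "ring_homomorphism (meval (\<lambda>c. mconst (msubst G (msubst G' c))) mvar)"
      by (rule ring_homomorphism_meval[OF ring_homomorphism_comp[OF ring_homomorphism_mconst
            ring_homomorphism_comp[OF ring_homomorphism_msubst ring_homomorphism_msubst]]])
  qed (simp_all add: subst_x_def s.zero s'.zero s.one s'.one c.zero c.one)
  also have "\<dots> = mconst C ^ p * meval mconst mvar (x_component p h)"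
    by (simp add: meval_def lookup_x_component round sum_distrib_left c.mult c.power mult.assoc)
  also have "meval mconst mvar (x_component p h) = x_component p h"
    using msubst_mvar_id[of "x_component p h"] by (simp only: msubst_def)
  finally show ?thesis .
qed

lemma module_times: "module ((*) :: 'r::comm_ring_1 \<Rightarrow> 'r \<Rightarrow> 'r)"
  by unfold_locales (simp_all add: algebra_simps)

lemma ideal_generated_subset_kernel:
  assumes "ring_homomorphism \<Phi>" "\<And>h. h \<in> S \<Longrightarrow> \<Phi> h = 0" "h \<in> ideal_generated S"
  shows "\<Phi> h = 0"
proof -
  interpret ring_homomorphism \<Phi> by fact
  interpret m: module "(*) :: 'a \<Rightarrow> 'a \<Rightarrow> 'a" by (rule module_times)
  show ?thesis
    using assms(3)[unfolded ideal_generated_def]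
    by (induction rule: m.span_induct_alt) (simp_all add: zero add mult assms(2))
qed

text \<open>An \<open>x\<close>-component of degree \<open>p\<close>, sent to \<open>B\<close> by \<open>G'\<close> and back by \<open>G\<close>, lands in the
  ideal of substituted elements and has been multiplied by \<open>C ^ p\<close>. Conversely the Rees ideal of
  \<open>A\<close> is the kernel of a map to a domain that does not kill \<open>C\<close>, hence it is saturated. The
  hypotheses are symmetric enough to apply to both directions of a Cremona map.\<close>

lemma rees_ideal_eq_saturation:
  fixes A B :: "'n::linorder option \<Rightarrow> ('n, 'k::field) mpoly"
  assumes "\<And>i. homogeneous e (A i)"
    and "\<And>i. msubst G (G' i) = mvar i * C" and "C \<noteq> 0"
    and BA: "\<And>h. h \<in> rees_ideal B \<Longrightarrow> subst_x G h \<in> rees_ideal A"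
    and AB: "\<And>h. h \<in> rees_ideal A \<Longrightarrow> subst_x G' h \<in> rees_ideal B"
  shows "rees_ideal A = saturation (ideal_subst_x (rees_ideal B) G) (mconst C)"
proof (intro subset_antisym subsetI)
  fix h assume h: "h \<in> rees_ideal A"
  interpret m: module "(*) :: ('n option, ('n, 'k) mpoly) mpoly \<Rightarrow> _ \<Rightarrow> _" by (rule module_times)
  let ?I = "ideal_subst_x (rees_ideal B) G"
  obtain S where S: "finite S" "h = (\<Sum>p\<in>S. x_component p h)" by (rule sum_x_components)
  \<comment> \<open>The exponents differ from one component to the next; the largest one works for all.\<close>
  define N where "N = Max (insert 0 S)"
  have "x_component p h * mconst C ^ N \<in> ?I" if "p \<in> S" for p
  proof -
    have "subst_x G (subst_x G' (x_component p h)) \<in> ?I"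
      unfolding ideal_subst_x_def ideal_generated_def
      using AB[OF x_component_in_rees_ideal[OF assms(1) h]] by (intro m.span_base) blast
    then have "mconst C ^ p * x_component p h \<in> ?I" 
      by (simp add: subst_x_roundtrip[OF assms(2)])
    then have "mconst C ^ (N - p) * (mconst C ^ p * x_component p h) \<in> ?I"
      unfolding ideal_subst_x_def ideal_generated_def by (rule m.span_scale)
    moreover have "p \<le> N" using S(1) that by (simp add: N_def)
    ultimately show ?thesis
      by (simp add: mult.assoc[symmetric] power_add[symmetric]) (simp add: mult.commute)
  qed
  then have "(\<Sum>p\<in>S. x_component p h * mconst C ^ N) \<in> ?I"
    unfolding ideal_subst_x_def ideal_generated_def by (rule m.span_sum)
  then have "h * mconst C ^ N \<in> ?I" using S(2) by (metis sum_distrib_right)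
  then show "h \<in> saturation ?I (mconst C)" by (auto simp: saturation_def ideal_colon_def)
next
  fix h assume "h \<in> saturation (ideal_subst_x (rees_ideal B) G) (mconst C)"
  then obtain u where u: "h * mconst C ^ u \<in> ideal_subst_x (rees_ideal B) G"
    by (auto simp: saturation_def ideal_colon_def)
  obtain \<Phi> where \<Phi>: "ring_homomorphism \<Phi>" "\<And>h. h \<in> rees_ideal A \<longleftrightarrow> \<Phi> h = 0"
    "\<And>c. \<Phi> (mconst c) = [:c:]" using rees_ideal_kernel by blast
  interpret ring_homomorphism \<Phi> by fact
  have "\<Phi> (h * mconst C ^ u) = 0"
    by (rule ideal_generated_subset_kernel[OF \<Phi>(1) _ u[unfolded ideal_subst_x_def]])
      (use BA \<Phi>(2) in blast)
  then have "\<Phi> h = 0" using assms(3) by (simp add: mult power \<Phi>(3))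
  then show "h \<in> rees_ideal A" by (simp add: \<Phi>(2))
qed

section \<open>Change of the parametrization by the Cremona map\<close>

lemma mutually_inverse_commute: "mutually_inverse a b \<Longrightarrow> mutually_inverse b a"
  by (auto simp: mutually_inverse_def)

lemma inversion_factor_nonzero:
  assumes "mutually_inverse G G'" "\<And>i. msubst G (G' i) = mvar i * C"
  shows "C \<noteq> 0"
  using assms by (auto simp: mutually_inverse_def same_rational_map_def rational_map_def rat_comp_def)

lemma msubst_append_embed_y: "msubst (append_coord a b) (embed_y p) = msubst a p"
  by (simp add: embed_y_def msubst_msubst append_coord_def)

lemma homogeneous_append_coord:
  assumes "\<And>i. homogeneous e (a i)" "homogeneous e b"
  shows "homogeneous e (append_coord a b i)"
  using assms by (simp add: append_coord_def split: option.split)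

text \<open>Over a field a polynomial of degree zero is zero or a unit. Consequently \<open>\<delta> - 1\<close> is
  never a truncated difference in the theorem.\<close>

lemma total_degree_irreducible_pos:
  fixes p :: "('v, 'k::field) mpoly"
  assumes "irreducible p"
  shows "total_degree p \<ge> 1"
proof (rule ccontr)
  assume "\<not> total_degree p \<ge> 1"
  then obtain c where c: "p = mconst c" using total_degree_eq_0D[of p] by auto
  interpret ring_homomorphism "mconst :: 'k \<Rightarrow> ('v, 'k) mpoly" by (rule ring_homomorphism_mconst)
  have "p * mconst (inverse c) = 1" if "c \<noteq> 0"
    using that by (simp add: c mult[symmetric] one)
  moreover have "c \<noteq> 0" using assms by (auto simp: c zero)
  ultimately have "p dvd 1" by (metis dvd_triv_left)
  then show False using assms by (simp add: irreducible_def)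
qed

theorem theorem4p5:
  fixes G G' :: "'n::{finite,linorder} \<Rightarrow> ('n, 'k::field) mpoly"
    and f g C D :: "('n, 'k) mpoly"
    and F :: "('n option, 'k) mpoly"
    and F\<^sub>\<delta> F\<^sub>\<delta>\<^sub>1 h\<^sub>\<delta> h\<^sub>\<delta>\<^sub>1 :: "('n, 'k) mpoly"
    and \<FF> \<MM> :: "'n option \<Rightarrow> ('n, 'k) mpoly"
    and d \<delta> :: nat
  assumes "infinite (UNIV :: 'k set)"
    and "cremona_map d G"
    and "cremona_inverse G G'"
    and "source_inversion_factor G G' C"
    and "target_inversion_factor G G' D"
    and "is_form f" and "is_form g" and "relatively_prime f g"
    and "total_degree f \<ge> 1"
    and "total_degree g = d + total_degree f"
    and "\<FF> = append_coord (\<lambda>i. f * G i) g"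
    and "implicit_equation \<FF> F"
    and "\<delta> = total_degree F"
    and "homogeneous \<delta> F\<^sub>\<delta>" and "homogeneous (\<delta> - 1) F\<^sub>\<delta>\<^sub>1"
    and "relatively_prime F\<^sub>\<delta> F\<^sub>\<delta>\<^sub>1"
    and "F = embed_y F\<^sub>\<delta> - mvar None * embed_y F\<^sub>\<delta>\<^sub>1"
    and "h\<^sub>\<delta> = msubst mvar F\<^sub>\<delta>" and "h\<^sub>\<delta>\<^sub>1 = msubst mvar F\<^sub>\<delta>\<^sub>1"
    and "\<MM> = append_coord (\<lambda>i. h\<^sub>\<delta>\<^sub>1 * mvar i) h\<^sub>\<delta>"
  shows "(\<forall>P. implicit_equation \<FF> P \<longleftrightarrow> implicit_equation \<MM> P)
    \<and> same_rational_map \<FF> (rat_comp \<MM> G)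
    \<and> rees_ideal \<FF> = saturation (ideal_subst_x (rees_ideal \<MM>) G) (mconst C)
    \<and> rees_ideal \<MM> = saturation (ideal_subst_x (rees_ideal \<FF>) G') (mconst D)"
proof -
  have inv: "mutually_inverse G G'" using assms(3) by (simp add: cremona_inverse_def)
  have C: "is_form C" "\<And>i. msubst G (G' i) = mvar i * C"
    using assms(4) by (auto simp: source_inversion_factor_def)
  have D: "is_form D" "\<And>i. msubst G' (G i) = mvar i * D"
    using assms(5) by (auto simp: target_inversion_factor_def)
  have C0: "C \<noteq> 0" by (rule inversion_factor_nonzero[OF inv C(2)])
  have D0: "D \<noteq> 0" by (rule inversion_factor_nonzero[OF mutually_inverse_commute[OF inv] D(2)])
  have injG: "msubst G p = 0 \<longleftrightarrow> p = 0" for p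
    using msubst_injective[OF D(2) D(1) D0] ring_homomorphism.zero[OF ring_homomorphism_msubst] by blast
  have injG': "msubst G' p = 0 \<longleftrightarrow> p = 0" for p
    using msubst_injective[OF C(2) C(1) C0] ring_homomorphism.zero[OF ring_homomorphism_msubst] by blast
  have homG: "\<And>i. homogeneous d (G i)" using assms(2) by (simp add: cremona_map_def)

  let ?\<beta> = "msubst G F\<^sub>\<delta>\<^sub>1"
  interpret sF: ring_homomorphism "msubst \<FF>" by (rule ring_homomorphism_msubst)
  interpret sG: ring_homomorphism "msubst G" by (rule ring_homomorphism_msubst)
  interpret sG': ring_homomorphism "msubst G'" by (rule ring_homomorphism_msubst)
  have MM: "\<MM> = append_coord (\<lambda>i. F\<^sub>\<delta>\<^sub>1 * mvar i) F\<^sub>\<delta>" using assms(18-20) by simp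
  have f0: "f \<noteq> 0" using assms(9) by (auto simp: total_degree_def)
  have g0: "g \<noteq> 0" using assms(9,10) by (auto simp: total_degree_def)
  define e where "e = d + total_degree f"
  have e: "e \<ge> 1" using assms(9) by (simp add: e_def)
  have homF: "homogeneous e (\<FF> i)" for i
    unfolding assms(11) e_def
  proof (rule homogeneous_append_coord)
    show "homogeneous (d + total_degree f) (f * G i)" for i
      using homogeneous_mult[OF homogeneous_total_degree[OF assms(6) f0] homG[of i]]
      by (simp add: add.commute)
    show "homogeneous (d + total_degree f) g"
      using homogeneous_total_degree[OF assms(7) g0] assms(10) by simp
  qed
  have \<delta>: "\<delta> \<ge> 1"
    using total_degree_irreducible_pos assms(12,13) by (auto simp: implicit_equation_def)
  have homM: "homogeneous \<delta> (\<MM> i)" for i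
    unfolding MM
  proof (rule homogeneous_append_coord)
    show "homogeneous \<delta> (F\<^sub>\<delta>\<^sub>1 * mvar i)" for i
      using homogeneous_mult[OF assms(15) homogeneous_mvar[of i]] \<delta> by simp
  qed (fact assms(14))

  have "F \<in> ideal_generated {F}"
    unfolding ideal_generated_def by (rule module.span_base[OF module_times]) simp
  then have "msubst \<FF> F = 0" using assms(12) by (auto simp: implicit_equation_def)
  moreover have "msubst \<FF> (embed_y p) = msubst (\<lambda>i. f * G i) p" for p
    unfolding assms(11) by (rule msubst_append_embed_y)
  moreover have "\<FF> None = g" by (simp add: assms(11) append_coord_def)
  ultimately have "msubst (\<lambda>i. f * G i) F\<^sub>\<delta> = g * msubst (\<lambda>i. f * G i) F\<^sub>\<delta>\<^sub>1"
    by (simp add: assms(17) ring_homomorphism_minus[OF ring_homomorphism_msubst] sF.mult)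
  \<comment> \<open>The coordinates of \<open>f G\<close> share the factor \<open>f\<close>, which comes out by homogeneity.\<close>
  then have "f ^ \<delta> * msubst G F\<^sub>\<delta> = g * (f ^ (\<delta> - 1) * ?\<beta>)"
    by (simp add: msubst_def meval_scale_homogeneous[OF assms(14)] meval_scale_homogeneous[OF assms(15)])
  then have "f ^ (\<delta> - 1) * (f * msubst G F\<^sub>\<delta>) = f ^ (\<delta> - 1) * (g * ?\<beta>)"
    using \<delta> by (cases \<delta>) (simp_all add: ac_simps)
  then have key: "f * msubst G F\<^sub>\<delta> = g * ?\<beta>" using f0 by simp
  \<comment> \<open>Otherwise both forms vanish, and the pair \<open>(0, 0)\<close> is not relatively prime.\<close>
  have F1: "F\<^sub>\<delta>\<^sub>1 \<noteq> 0"
  proof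
    assume 0: "F\<^sub>\<delta>\<^sub>1 = 0"
    then have "F\<^sub>\<delta> = 0" using key f0 injG by (simp add: sG.zero)
    then have "(0 :: ('n, 'k) mpoly) dvd 1" using assms(16) 0 by (auto simp: relatively_prime_def)
    then show False by simp
  qed
  have \<beta>: "?\<beta> \<noteq> 0" using F1 injG by simp
  have proportional: "?\<beta> * \<FF> i = f * msubst G (\<MM> i)" for i
    by (cases i) (simp_all add: assms(11) MM append_coord_def sG.mult key ac_simps)
  \<comment> \<open>The same proportionality after substituting \<open>G'\<close>: it compares \<open>\<FF>(G')\<close> with \<open>\<MM>\<close>.\<close>
  have twisted: "msubst G' ?\<beta> * msubst G' (\<FF> i) = (msubst G' f * D ^ \<delta>) * \<MM> i" for i
  proof -
    have "msubst G' (msubst G (\<MM> i)) = D ^ \<delta> * \<MM> i"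
      by (simp only: msubst_msubst D(2) msubst_multiple_of_variables[OF homM])
    then show ?thesis using arg_cong[OF proportional[of i], of "msubst G'"]
      by (simp add: sG'.mult mult.assoc)
  qed

  have kernel: "msubst \<FF> Q = 0 \<longleftrightarrow> msubst \<MM> Q = 0" for Q
  proof -
    have "msubst \<FF> (hom_component j Q) = 0 \<longleftrightarrow> msubst \<MM> (hom_component j Q) = 0" for j
    proof -
      have "msubst \<FF> (hom_component j Q) = 0 \<longleftrightarrow> msubst (\<lambda>i. msubst G (\<MM> i)) (hom_component j Q) = 0"
        unfolding msubst_def[where a = \<FF>] msubst_def[where a = "\<lambda>i. msubst G (\<MM> i)"]
        by (rule proportional_tuples_vanish_iff[OF homogeneous_hom_component \<beta> f0 proportional])
      then show ?thesis by (simp add: msubst_msubst[symmetric] injG)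
    qed
    then show ?thesis
      by (simp only: msubst_eq_0_iff_components[where a = \<FF> and p = Q, OF homF e]
          msubst_eq_0_iff_components[where a = \<MM> and p = Q, OF homM \<delta>])
  qed
  have krull: "krull_dim (range (msubst \<FF>)) = krull_dim (range (msubst \<MM>))"
    by (rule krull_dim_range_cong) (simp_all add: ring_homomorphism_msubst kernel)
  have a: "implicit_equation \<FF> P \<longleftrightarrow> implicit_equation \<MM> P" for P
  proof -
    have "\<exists>d. \<forall>i. homogeneous d (\<FF> i)" "\<exists>d. \<forall>i. homogeneous d (\<MM> i)"
      using homF homM by blast+
    then show ?thesis by (simp only: implicit_equation_def krull kernel)
  qed

  have b: "same_rational_map \<FF> (rat_comp \<MM> G)"
    unfolding same_rational_map_def
  proof (intro conjI allI)
    show "rational_map \<FF>"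
      unfolding rational_map_def
    proof (intro conjI)
      show "\<exists>d. \<forall>i. homogeneous d (\<FF> i)" using homF by blast
      have "\<FF> None = g" by (simp add: assms(11) append_coord_def)
      then show "\<exists>i. \<FF> i \<noteq> 0" using g0 by metis
    qed
    have "homogeneous (\<delta> * d) (rat_comp \<MM> G i)" for i
      unfolding rat_comp_def by (rule homogeneous_msubst[OF homG homM])
    moreover have "rat_comp \<MM> G (Some undefined) \<noteq> 0"
      using F1 by (simp add: rat_comp_def injG MM append_coord_def mvar_neq_0)
    ultimately show "rational_map (rat_comp \<MM> G)" unfolding rational_map_def by blast
    fix i j
    have "f * (\<FF> i * msubst G (\<MM> j)) = f * (\<FF> j * msubst G (\<MM> i))"
    proof -
      have "f * (\<FF> i * msubst G (\<MM> j)) = \<FF> i * (?\<beta> * \<FF> j)"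
        by (simp only: proportional mult.left_commute)
      also have "\<dots> = \<FF> j * (?\<beta> * \<FF> i)"
        by (simp only: mult_ac)
      also have "\<dots> = f * (\<FF> j * msubst G (\<MM> i))"
        by (simp only: proportional mult.left_commute)
      finally show ?thesis .
    qed
    then show "\<FF> i * rat_comp \<MM> G j = \<FF> j * rat_comp \<MM> G i"
      using f0 by (simp add: rat_comp_def)
  qed

  have FM: "rees_ideal \<FF> = rees_ideal (\<lambda>i. msubst G (\<MM> i))"
    by (rule rees_ideal_proportional[OF \<beta> f0 proportional])
  have MF: "rees_ideal (\<lambda>i. msubst G' (\<FF> i)) = rees_ideal \<MM>"
    by (rule rees_ideal_proportional[OF _ _ twisted]) (simp_all add: \<beta> f0 D0 injG')
  have toF: "subst_x G h \<in> rees_ideal \<FF>" if "h \<in> rees_ideal \<MM>" for h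
    using subst_x_in_rees_ideal[OF that, of G] FM by simp
  have toM: "subst_x G' h \<in> rees_ideal \<MM>" if "h \<in> rees_ideal \<FF>" for h
    using subst_x_in_rees_ideal[OF that, of G'] MF by simp
  show ?thesis
    using a b rees_ideal_eq_saturation[where A = \<FF> and B = \<MM>, OF homF C(2) C0 toF toM]
      rees_ideal_eq_saturation[where A = \<MM> and B = \<FF>, OF homM D(2) D0 toM toF] by blast
qed

end
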